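(* Let $X$ be a Banach space and let $Y=\ell_\infty$. Then the following are equivalent: (i) $X$ coarsely embeds into $Y$; (ii) $X$ uniformly embeds into $Y$; (iii) $X$ strongly embeds into $Y$; (iv) $X$ maps into $Y$ by a map which is coarse and solvent; (v) $X$ maps into $Y$ by a map which is uniformly continuous and almost uncollapsed; (vi) $X$ Lipschitz embeds into $Y$.
   Context: All Banach spaces are over the reals; $\ell_\infty=\ell_\infty(\mathbb{N})$ with the supremum norm. Let $f:(M,d)\to(N,\partial)$ be a map between metric spaces. For $t\ge0$ set $\omega_f(t)=\sup\{\partial(f(x),f(y)): d(x,y)\le t\}$, $\rho_f(t)=\inf\{\partial(f(x),f(y)): d(x,y)\ge t\}$ and $\overline{\rho}_f(t)=\inf\{\partial(f(x),f(y)): d(x,y)=t\}$ (with $\inf\emptyset=+\infty$). The map $f$ is a uniform embedding if it is injective and both $f$ and $f^{-1}$ (defined on the image) are uniformly continuous, i.e. $\lim_{t\to0^+}\omega_f(t)=0$ and $\rho_f(t)>0$ for all $t>0$. It is coarse if $\omega_f(t)<\infty$ for all $t\ge0$, expanding if $\lim_{t\to\infty}\rho_f(t)=\infty$, a coarse embedding if it is both coarse and expanding, and a strong embedding if it is both a uniform and a coarse embedding. It is solvent if for each $n\in\mathbb{N}$ there is $R>0$ such that for all $x,y\in M$, $d(x,y)\in[R,R+n]$ implies $\partial(f(x),f(y))>n$; and almost uncollapsed if $\overline{\rho}_f(t)>0$ for some $t>0$. It is a Lipschitz embedding if it is injective and both $f$ and $f^{-1}$ (defined on the image) are Lipschitz.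 $X$ coarsely (uniformly, strongly, Lipschitz) embeds into $Y$ if there is an embedding $X\to Y$ of the corresponding kind. *)

theory Defs
  imports "HOL-Analysis.Analysis"
begin

(* The Banach space of bounded real sequences with the supremum norm. Since nat carries the
   discrete topology, bounded continuous functions on nat are exactly the bounded sequences;
   norm and distance are the supremum ones by norm_bcontfun_def and dist_bcontfun_def. *)
type_synonym linfty = "nat \<Rightarrow>\<^sub>C real"

lemma bounded_sequence_is_linfty:
  fixes s :: "nat \<Rightarrow> real"
  assumes "bounded (range s)"
  obtains x :: linfty where "\<And>n. apply_bcontfun x n = s n"
proof -
  have "s \<in> bcontfun"
    using assms by (auto simp: bcontfun_def)
  then show thesis
    using that[of "Bcontfun s"] by (simp add: Bcontfun_inverse)
qed

lemma norm_linfty: "norm (x :: linfty) = (SUP n. \<bar>apply_bcontfun x n\<bar>)"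
  by (simp add: norm_bcontfun_def dist_bcontfun_def)

(* The moduli take values in ennreal, where the infimum of the empty set is infinity. *)

definition omega_mod :: "('a::metric_space \<Rightarrow> 'b::metric_space) \<Rightarrow> real \<Rightarrow> ennreal" where
  "omega_mod f t = (SUP (x, y) \<in> {(x, y). dist x y \<le> t}. ennreal (dist (f x) (f y)))"

definition rho_mod :: "('a::metric_space \<Rightarrow> 'b::metric_space) \<Rightarrow> real \<Rightarrow> ennreal" where
  "rho_mod f t = (INF (x, y) \<in> {(x, y). dist x y \<ge> t}. ennreal (dist (f x) (f y)))"

definition rho_bar_mod :: "('a::metric_space \<Rightarrow> 'b::metric_space) \<Rightarrow> real \<Rightarrow> ennreal" where
  "rho_bar_mod f t = (INF (x, y) \<in> {(x, y). dist x y = t}. ennreal (dist (f x) (f y)))"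

definition uniform_embedding :: "('a::metric_space \<Rightarrow> 'b::metric_space) \<Rightarrow> bool" where
  "uniform_embedding f \<longleftrightarrow>
     inj f \<and> uniformly_continuous_on UNIV f \<and> uniformly_continuous_on (range f) (inv f)"

definition coarse_map :: "('a::metric_space \<Rightarrow> 'b::metric_space) \<Rightarrow> bool" where
  "coarse_map f \<longleftrightarrow> (\<forall>t\<ge>0. omega_mod f t < \<infinity>)"

definition expanding_map :: "('a::metric_space \<Rightarrow> 'b::metric_space) \<Rightarrow> bool" where
  "expanding_map f \<longleftrightarrow> (rho_mod f \<longlongrightarrow> \<infinity>) at_top"

definition coarse_embedding :: "('a::metric_space \<Rightarrow> 'b::metric_space) \<Rightarrow> bool" where
  "coarse_embedding f \<longleftrightarrow> coarse_map f \<and> expanding_map f"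

definition strong_embedding :: "('a::metric_space \<Rightarrow> 'b::metric_space) \<Rightarrow> bool" where
  "strong_embedding f \<longleftrightarrow> uniform_embedding f \<and> coarse_embedding f"

definition solvent :: "('a::metric_space \<Rightarrow> 'b::metric_space) \<Rightarrow> bool" where
  "solvent f \<longleftrightarrow> (\<forall>n::nat. \<exists>R>0. \<forall>x y.
     dist x y \<in> {R..R + real n} \<longrightarrow> dist (f x) (f y) > real n)"

definition almost_uncollapsed :: "('a::metric_space \<Rightarrow> 'b::metric_space) \<Rightarrow> bool" where
  "almost_uncollapsed f \<longleftrightarrow> (\<exists>t>0. rho_bar_mod f t > 0)"

definition lipschitz_embedding :: "('a::metric_space \<Rightarrow> 'b::metric_space) \<Rightarrow> bool" where
  "lipschitz_embedding f \<longleftrightarrow>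
     inj f \<and> (\<exists>C. C-lipschitz_on UNIV f) \<and> (\<exists>C. C-lipschitz_on (range f) (inv f))"

(* The two descriptions of uniform continuity and uniform embeddings, via the usual
   epsilon-delta notion and via the moduli, agree. *)

lemma omega_mod_le_iff:
  assumes "e \<ge> 0"
  shows "omega_mod f t \<le> ennreal e \<longleftrightarrow> (\<forall>x y. dist x y \<le> t \<longrightarrow> dist (f x) (f y) \<le> e)"
  using assms by (auto simp: omega_mod_def SUP_le_iff)

lemma uniformly_continuous_iff_omega_mod:
  "uniformly_continuous_on UNIV f \<longleftrightarrow> (omega_mod f \<longlongrightarrow> 0) (at_right 0)"
proof
  assume u: "uniformly_continuous_on UNIV f"
  show "(omega_mod f \<longlongrightarrow> 0) (at_right 0)"
  proof (rule order_tendstoI)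
    fix a :: ennreal assume "0 < a"
    then obtain b where b: "0 < b" "b < a" using dense by blast
    define e where "e = enn2real b"
    have be: "b = ennreal e" using b by (simp add: e_def top.not_eq_extremum order_less_le_trans[OF b(2)])
    have "e > 0" using b(1) unfolding be by simp
    then obtain d where d: "d > 0" "\<And>x y. dist x y < d \<Longrightarrow> dist (f x) (f y) < e"
      using u unfolding uniformly_continuous_on_def by (metis UNIV_I)
    have "omega_mod f t < a" if "t < d" for t
    proof -
      have "omega_mod f t \<le> ennreal e"
        using d(2) that \<open>e > 0\<close> by (subst omega_mod_le_iff) (auto intro: less_imp_le)
      then show ?thesis using b be by auto
    qed
    then show "\<forall>\<^sub>F t in at_right 0. omega_mod f t < a"
      using d(1) by (auto simp: eventually_at_right_field)
  qed auto
next
  assume l: "(omega_mod f \<longlongrightarrow> 0) (at_right 0)"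
  show "uniformly_continuous_on UNIV f"
    unfolding uniformly_continuous_on_def
  proof (intro allI impI)
    fix e :: real assume "e > 0"
    then have "\<forall>\<^sub>F t in at_right 0. omega_mod f t < ennreal (e/2)"
      using order_tendstoD(2)[OF l, of "ennreal (e/2)"] by simp
    then obtain b where b: "b > 0" "\<And>t. 0 < t \<Longrightarrow> t < b \<Longrightarrow> omega_mod f t < ennreal (e/2)"
      by (auto simp: eventually_at_right_field)
    have "omega_mod f (b/2) \<le> ennreal (e/2)" using b by (auto intro: less_imp_le)
    then have le: "dist (f x) (f y) \<le> e/2" if "dist x y \<le> b/2" for x y
      using \<open>e > 0\<close> that by (subst (asm) omega_mod_le_iff) auto
    have "dist (f y) (f x) < e" if "dist y x < b/2" for x y
      using le[of y x] that \<open>e > 0\<close> by linarith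
    then show "\<exists>d>0. \<forall>x\<in>UNIV. \<forall>x'\<in>UNIV. dist x' x < d \<longrightarrow> dist (f x') (f x) < e"
      using \<open>b > 0\<close> by (intro exI[of _ "b/2"]) simp
  qed
qed

lemma rho_mod_ge_iff:
  "ennreal e \<le> rho_mod f t \<longleftrightarrow> (\<forall>x y. dist x y \<ge> t \<longrightarrow> e \<le> dist (f x) (f y))"
  by (auto simp: rho_mod_def le_INF_iff)

lemma rho_mod_pos_iff:
  "rho_mod f t > 0 \<longleftrightarrow> (\<exists>e>0. \<forall>x y. dist x y \<ge> t \<longrightarrow> e \<le> dist (f x) (f y))"
proof
  assume "rho_mod f t > 0"
  then obtain b where b: "0 < b" "b < rho_mod f t" using dense by blast
  define e where "e = enn2real b"
  have be: "b = ennreal e" using b by (simp add: e_def top.not_eq_extremum order_less_le_trans[OF b(2)])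
  then have "e > 0" by (metis b(1) ennreal_less_zero_iff)
  with b be show "\<exists>e>0. \<forall>x y. dist x y \<ge> t \<longrightarrow> e \<le> dist (f x) (f y)"
    using rho_mod_ge_iff[of e f t] by auto
next
  assume "\<exists>e>0. \<forall>x y. dist x y \<ge> t \<longrightarrow> e \<le> dist (f x) (f y)"
  then obtain e where "e > 0" "ennreal e \<le> rho_mod f t" using rho_mod_ge_iff[of _ f t] by blast
  then show "rho_mod f t > 0" by (metis ennreal_less_zero_iff order_less_le_trans)
qed

lemma uniform_embedding_iff_moduli:
  "uniform_embedding f \<longleftrightarrow> (omega_mod f \<longlongrightarrow> 0) (at_right 0) \<and> (\<forall>t>0. rho_mod f t > 0)"
proof -
  have "inj f \<and> uniformly_continuous_on (range f) (inv f) \<longleftrightarrow> (\<forall>t>0. rho_mod f t > 0)"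
    (is "?L \<longleftrightarrow> ?R")
  proof
    assume ?L
    show ?R
    proof (intro allI impI)
      fix t :: real assume "t > 0"
      then obtain d where "d > 0" "\<And>x y. dist (f x) (f y) < d \<Longrightarrow> dist x y < t"
        using \<open>?L\<close> unfolding uniformly_continuous_on_def by (metis inv_f_f rangeI)
      then show "rho_mod f t > 0"
        unfolding rho_mod_pos_iff by (meson not_le)
    qed
  next
    assume ?R
    have *: "\<exists>e>0. \<forall>x y. dist (f x) (f y) < e \<longrightarrow> dist x y < t" if "t > 0" for t
      using \<open>?R\<close> that unfolding rho_mod_pos_iff by (meson not_le)
    have "inj f"
      by (rule injI) (metis * dist_self less_irrefl zero_less_dist_iff)
    moreover have "uniformly_continuous_on (range f) (inv f)"
      unfolding uniformly_continuous_on_def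
    proof (intro allI impI)
      fix t :: real assume "t > 0"
      from *[OF this] obtain e where "e > 0" "\<And>x y. dist (f x) (f y) < e \<Longrightarrow> dist x y < t"
        by blast
      then show "\<exists>e>0. \<forall>u\<in>range f. \<forall>v\<in>range f. dist v u < e \<longrightarrow> dist (inv f v) (inv f u) < t"
        using \<open>inj f\<close> by (intro exI[of _ e]) auto
    qed
    ultimately show ?L by blast
  qed
  then show ?thesis
    by (auto simp: uniform_embedding_def uniformly_continuous_iff_omega_mod)
qed

end

theory Submission
  imports Defs
begin

text \<open>
  Each of the conditions follows from the Lipschitz one by a direct estimate, so the content is that
  the two weakest conditions, ``coarse and solvent'' and ``uniformly continuous and almost
  uncollapsed'', each produce a Lipschitz embedding. Both give a map \<open>f\<close> into \<open>\<ell>\<^sub>\<infinity>\<close> with an affine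
  growth bound \<open>\<parallel>f x - f y\<parallel> \<le> K \<parallel>x - y\<parallel> + B\<close> (subdivide the segment from \<open>x\<close> to \<open>y\<close>) that separates
  the pairs at one single distance \<open>t\<close> by more than \<open>B\<close>: in the solvent case \<open>B\<close> is fixed and the
  separation can be made as large as desired, while in the uniformly continuous case the separation
  is fixed and \<open>B\<close> can be made as small as desired.

  From such a map an embedding is built in two steps, both of which use that a map into \<open>\<ell>\<^sub>\<infinity>\<close> is
  just a sequence of real functions. First, the inf-convolution of each coordinate with \<open>K \<parallel>\<cdot>\<parallel>\<close> is
  \<open>K\<close>-Lipschitz and lies within \<open>B\<close> below that coordinate (\<open>lipschitz_minorant\<close>); so the new
  coordinates still separate pairs at distance \<open>t\<close> uniformly. Secondly, the dilations
  \<open>x \<mapsto> q g (x / q)\<close> of a \<open>K\<close>-Lipschitz function \<open>g\<close> are again \<open>K\<close>-Lipschitz, and they separate pairs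
  at distance \<open>q t\<close> by an amount proportional to \<open>q\<close>. Letting \<open>q\<close> range over the rationals keeps the
  family countable, hence indexable as one sequence. The distances \<open>q t\<close> are dense, and a pair at any
  distance can be moved to a pair at a nearby distance \<open>q t\<close> along the line through it, at a cost that
  the Lipschitz bound controls (\<open>lipschitz_embedding_of_sphere_separation\<close>).
\<close>

section \<open>Lipschitz embeddings assembled from countably many real functions\<close>

text \<open>
  The inf-convolution \<open>g x = inf\<^sub>y (f y + K dist x y)\<close>. It is \<open>K\<close>-Lipschitz as an infimum of such
  functions, it is at most \<open>f x\<close> by the choice \<open>y = x\<close>, and the growth bound on \<open>f\<close> says exactly
  that every competitor is at least \<open>f x - B\<close>.
\<close>

lemma lipschitz_minorant:
  fixes f :: "'a::metric_space \<Rightarrow> real"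
  assumes "0 \<le> K" and growth: "\<And>x y. f x - f y \<le> K * dist x y + B"
  obtains g where "K-lipschitz_on UNIV g" "\<And>x. g x \<le> f x" "\<And>x. f x - B \<le> g x"
proof
  define g where "g x = (INF y. f y + K * dist x y)" for x
  have lower: "f x - B \<le> f y + K * dist x y" for x y
    using growth[of x y] by simp
  then have bdd: "bdd_below (range (\<lambda>y. f y + K * dist x y))" for x
    by (intro bdd_belowI[of _ "f x - B"]) auto
  show "g x \<le> f x" for x
    using cINF_lower[OF bdd[of x], of x] by (simp add: g_def)
  show "f x - B \<le> g x" for x
    unfolding g_def using lower by (intro cINF_greatest) auto
  have one_sided: "g x \<le> g y + K * dist x y" for x y
  proof -
    have "g x - K * dist x y \<le> f z + K * dist y z" for z
    proof -
      have "g x \<le> f z + K * dist x z"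
        unfolding g_def by (rule cINF_lower[OF bdd]) simp
      also have "K * dist x z \<le> K * (dist x y + dist y z)"
        using \<open>0 \<le> K\<close> by (intro mult_left_mono dist_triangle)
      finally show ?thesis by (simp add: algebra_simps)
    qed
    then have "g x - K * dist x y \<le> g y"
      unfolding g_def[of y] by (intro cINF_greatest) auto
    then show ?thesis by simp
  qed
  show "K-lipschitz_on UNIV g"
  proof (rule lipschitz_onI)
    show "dist (g x) (g y) \<le> K * dist x y" for x y
      using one_sided[of x y] one_sided[of y x] by (simp add: dist_real_def dist_commute abs_le_iff)
  qed fact
qed

lemma lipschitz_embeddingI:
  fixes f :: "'a::metric_space \<Rightarrow> 'b::metric_space"
  assumes "0 \<le> C" and upper: "\<And>x y. dist (f x) (f y) \<le> C * dist x y"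
    and "0 < c" and lower: "\<And>x y. c * dist x y \<le> dist (f x) (f y)"
  shows "lipschitz_embedding f"
proof -
  have "inj f"
  proof (rule injI)
    fix x y assume "f x = f y"
    then have "c * dist x y \<le> 0" using lower[of x y] by simp
    then show "x = y" using \<open>0 < c\<close> by (simp add: mult_le_0_iff)
  qed
  moreover have "C-lipschitz_on UNIV f"
    using assms by (intro lipschitz_onI) auto
  moreover have "(1 / c)-lipschitz_on (range f) (inv f)"
  proof (rule lipschitz_onI)
    fix u v assume "u \<in> range f" "v \<in> range f"
    then show "dist (inv f u) (inv f v) \<le> 1 / c * dist u v"
      using lower \<open>inj f\<close> \<open>0 < c\<close> by (auto simp: field_simps)
  qed (use \<open>0 < c\<close> in simp)
  ultimately show ?thesis
    unfolding lipschitz_embedding_def by blast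
qed

lemma lipschitz_embeddingE:
  fixes f :: "'a::metric_space \<Rightarrow> 'b::metric_space"
  assumes "lipschitz_embedding f"
  obtains C c where "0 \<le> C" "\<And>x y. dist (f x) (f y) \<le> C * dist x y"
    and "0 < c" "\<And>x y. c * dist x y \<le> dist (f x) (f y)"
proof -
  from assms obtain C D where "inj f" and C: "C-lipschitz_on UNIV f"
    and D: "D-lipschitz_on (range f) (inv f)"
    unfolding lipschitz_embedding_def by blast
  have "0 \<le> D" using D by (rule lipschitz_on_nonneg)
  show thesis
  proof (rule that)
    show "0 \<le> C" using C by (rule lipschitz_on_nonneg)
    show "dist (f x) (f y) \<le> C * dist x y" for x y
      using lipschitz_onD[OF C] by simp
    \<comment> \<open>\<open>D + 1\<close> because \<open>D\<close> itself may be \<open>0\<close> on a one-point space.\<close>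
    show "0 < 1 / (D + 1)" using \<open>0 \<le> D\<close> by simp
    show "1 / (D + 1) * dist x y \<le> dist (f x) (f y)" for x y
    proof -
      have "dist x y \<le> D * dist (f x) (f y)"
        using lipschitz_onD[OF D, of "f x" "f y"] \<open>inj f\<close> by simp
      also have "\<dots> \<le> (D + 1) * dist (f x) (f y)"
        by (simp add: mult_right_mono)
      finally show ?thesis using \<open>0 \<le> D\<close> by (simp add: field_simps)
    qed
  qed
qed

text \<open>
  Equi-Lipschitz functions that vanish at a common point are pointwise bounded, so a countable family
  of them is a map into \<open>\<ell>\<^sub>\<infinity>\<close>; its lower Lipschitz bound may be verified by a different function for
  each pair of points.
\<close>

lemma lipschitz_embedding_of_countable_family:
  fixes h :: "'i::countable \<Rightarrow> 'a::metric_space \<Rightarrow> real"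
  assumes lip: "\<And>i. K-lipschitz_on UNIV (h i)" and base: "\<And>i. h i a = 0"
    and "0 < c" and sep: "\<And>x y. x \<noteq> y \<Longrightarrow> \<exists>i. c * dist x y \<le> \<bar>h i x - h i y\<bar>"
  shows "\<exists>F :: 'a \<Rightarrow> linfty. lipschitz_embedding F"
proof -
  have le: "\<bar>h i x - h i y\<bar> \<le> K * dist x y" for i x y
    using lipschitz_onD[OF lip] by (simp add: dist_real_def)
  have "\<exists>u :: linfty. \<forall>n. apply_bcontfun u n = h (from_nat n) x" for x
  proof -
    have "bounded (range (\<lambda>n::nat. h (from_nat n) x))"
      using le[of _ x a] by (intro boundedI[of _ "K * dist x a"]) (auto simp: base)
    then show ?thesis
      using bounded_sequence_is_linfty by metis
  qed
  then obtain F :: "'a \<Rightarrow> linfty" where F: "\<And>x n. apply_bcontfun (F x) n = h (from_nat n) x"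
    by metis
  have "lipschitz_embedding F"
  proof (rule lipschitz_embeddingI)
    show "0 \<le> K" using lip by (rule lipschitz_on_nonneg)
    show "dist (F x) (F y) \<le> K * dist x y" for x y
      using le by (intro dist_bound) (simp add: F dist_real_def)
    show "c * dist x y \<le> dist (F x) (F y)" for x y
    proof (cases "x = y")
      case False
      then obtain i where "c * dist x y \<le> \<bar>h i x - h i y\<bar>" using sep by blast
      also have "\<dots> = dist (F x (to_nat i)) (F y (to_nat i))"
        by (simp add: F dist_real_def)
      also have "\<dots> \<le> dist (F x) (F y)" by (rule dist_bounded)
      finally show ?thesis .
    qed simp
  qed fact
  then show ?thesis by blast
qed

section \<open>From separation at one distance to a Lipschitz embedding\<close>

text \<open>
  The bound does not depend on the scale \<open>q\<close>, which is what allows all scales in one embedding.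
  For \<open>q = 0\<close> the function is \<open>0\<close>.
\<close>

lemma lipschitz_on_dilation:
  fixes g :: "'a::real_normed_vector \<Rightarrow> real"
  assumes "K-lipschitz_on UNIV g"
  shows "K-lipschitz_on UNIV (\<lambda>x. q * (g (x /\<^sub>R q) - g 0))"
proof (rule lipschitz_onI)
  show K: "0 \<le> K" using assms by (rule lipschitz_on_nonneg)
  fix x y :: 'a
  have "dist (q * (g (x /\<^sub>R q) - g 0)) (q * (g (y /\<^sub>R q) - g 0))
      = \<bar>q\<bar> * dist (g (x /\<^sub>R q)) (g (y /\<^sub>R q))"
    by (simp add: dist_real_def flip: abs_mult right_diff_distrib)
  also have "\<dots> \<le> \<bar>q\<bar> * (K * dist (x /\<^sub>R q) (y /\<^sub>R q))"
    using lipschitz_onD[OF assms] by (intro mult_left_mono) auto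
  also have "dist (x /\<^sub>R q) (y /\<^sub>R q) = dist x y / \<bar>q\<bar>"
    by (simp add: dist_norm divide_inverse mult.commute flip: scaleR_diff_right)
  also have "\<bar>q\<bar> * (K * (dist x y / \<bar>q\<bar>)) \<le> K * dist x y"
    using K by simp
  finally show "dist (q * (g (x /\<^sub>R q) - g 0)) (q * (g (y /\<^sub>R q) - g 0)) \<le> K * dist x y" .
qed

text \<open>
  To separate \<open>x\<close> and \<open>y\<close> at distance \<open>s\<close>, replace \<open>y\<close> by the point \<open>z\<close> of the segment from \<open>x\<close> to
  \<open>y\<close> at distance \<open>q t < s\<close> from \<open>x\<close>. The dilation by \<open>q\<close> of some \<open>g n\<close> separates \<open>x\<close> from \<open>z\<close> by
  \<open>q e\<close>, and passing from \<open>z\<close> to \<open>y\<close> loses at most \<open>K (s - q t)\<close>.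
\<close>

lemma lipschitz_embedding_of_lipschitz_sphere_separation:
  fixes g :: "'i::countable \<Rightarrow> 'a::real_normed_vector \<Rightarrow> real"
  assumes lip: "\<And>n. K-lipschitz_on UNIV (g n)" and "0 < t" "0 < e"
    and sep: "\<And>x y. dist x y = t \<Longrightarrow> \<exists>n. e \<le> \<bar>g n x - g n y\<bar>"
  shows "\<exists>F :: 'a \<Rightarrow> linfty. lipschitz_embedding F"
proof -
  define h where "h = (\<lambda>(n, r) x. of_rat r * (g n (x /\<^sub>R of_rat r) - g n 0))"
  define c where "c = e / (2 * t)"
  have "0 < c" using \<open>0 < t\<close> \<open>0 < e\<close> by (simp add: c_def)
  have "0 \<le> K" using lip by (rule lipschitz_on_nonneg)
  have hlip: "K-lipschitz_on UNIV (h i)" for i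
    unfolding h_def by (cases i) (simp add: lipschitz_on_dilation[OF lip])
  show ?thesis
  proof (rule lipschitz_embedding_of_countable_family[OF hlip _ \<open>0 < c\<close>])
    show "h i 0 = 0" for i by (cases i) (simp add: h_def)
    fix x y :: 'a assume "x \<noteq> y"
    define s where "s = dist x y"
    have "0 < e + K * t"
      using \<open>0 \<le> K\<close> \<open>0 < t\<close> \<open>0 < e\<close> by (simp add: add_pos_nonneg)
    have "0 < s" using \<open>x \<noteq> y\<close> by (simp add: s_def)
    \<comment> \<open>The lower bound on the scale is what \<open>q e - K (s - q t) \<ge> c s\<close> requires; it lies below
      \<open>s / t\<close> because \<open>c t < e\<close>.\<close>
    have "s * (K + c) / (e + K * t) < s / t"
    proof -
      have "(K + c) * t < e + K * t"
        using \<open>0 < t\<close> \<open>0 < e\<close> by (simp add: c_def field_simps)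
      then show ?thesis
        using \<open>0 < e + K * t\<close> \<open>0 < t\<close> \<open>0 < s\<close> by (simp add: field_simps)
    qed
    then obtain r where r: "s * (K + c) / (e + K * t) < of_rat r" "of_rat r < s / t"
      using of_rat_dense by blast
    define q :: real where "q = of_rat r"
    have "0 \<le> s * (K + c) / (e + K * t)"
      using \<open>0 \<le> K\<close> \<open>0 < c\<close> \<open>0 < t\<close> \<open>0 < e\<close> \<open>0 < s\<close> by simp
    then have "0 < q" using r(1) unfolding q_def by (rule order_le_less_trans)
    have qt: "q * t < s" using r(2) \<open>0 < t\<close> by (simp add: q_def field_simps)
    have gain: "c * s \<le> q * e - K * (s - q * t)"
      using r(1) \<open>0 < e + K * t\<close> by (simp add: q_def field_simps)
    define z where "z = x + (q * t / s) *\<^sub>R (y - x)"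
    have xz: "dist x z = q * t"
      using \<open>0 < q\<close> \<open>0 < t\<close> \<open>0 < s\<close>
      by (simp add: z_def dist_norm s_def norm_minus_commute)
    have zy: "dist z y = s - q * t"
    proof -
      have "z - y = (1 - q * t / s) *\<^sub>R (x - y)"
        by (simp add: z_def algebra_simps)
      then have "dist z y = \<bar>1 - q * t / s\<bar> * s"
        by (simp add: dist_norm s_def)
      also have "\<dots> = s - q * t"
        using qt \<open>0 < s\<close> by (simp add: field_simps)
      finally show ?thesis .
    qed
    have "dist (x /\<^sub>R q) (z /\<^sub>R q) = t"
      using xz \<open>0 < q\<close> by (simp add: dist_norm flip: scaleR_diff_right)
    then obtain n where n: "e \<le> \<bar>g n (x /\<^sub>R q) - g n (z /\<^sub>R q)\<bar>"
      using sep by blast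
    have "q * e \<le> q * \<bar>g n (x /\<^sub>R q) - g n (z /\<^sub>R q)\<bar>"
      using n \<open>0 < q\<close> by (intro mult_left_mono) auto
    also have "\<dots> = \<bar>h (n, r) x - h (n, r) z\<bar>"
      using \<open>0 < q\<close> by (simp add: h_def abs_mult flip: q_def right_diff_distrib)
    finally have "q * e \<le> \<bar>h (n, r) x - h (n, r) z\<bar>" .
    moreover have "\<bar>h (n, r) z - h (n, r) y\<bar> \<le> K * (s - q * t)"
      using lipschitz_onD[OF hlip, of z y "(n, r)"] zy by (simp add: dist_real_def)
    ultimately have "c * dist x y \<le> \<bar>h (n, r) x - h (n, r) y\<bar>"
      using gain unfolding s_def by linarith
    then show "\<exists>i. c * dist x y \<le> \<bar>h i x - h i y\<bar>" ..
  qed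
qed

text \<open>
  The Lipschitz minorants of the coordinates of \<open>f\<close> all err in the same direction, by at most \<open>B\<close>,
  so differences change by at most \<open>B\<close>; any separation larger than \<open>B\<close> survives.
\<close>

lemma lipschitz_embedding_of_sphere_separation:
  fixes f :: "'a::real_normed_vector \<Rightarrow> linfty"
  assumes "0 \<le> K" and growth: "\<And>x y. dist (f x) (f y) \<le> K * dist x y + B"
    and "0 < t" "B < d" and sep: "\<And>x y. dist x y = t \<Longrightarrow> d \<le> dist (f x) (f y)"
  shows "\<exists>F :: 'a \<Rightarrow> linfty. lipschitz_embedding F"
proof -
  have "\<exists>g. K-lipschitz_on UNIV g \<and> (\<forall>x. g x \<le> f x n) \<and> (\<forall>x. f x n - B \<le> g x)" for n
  proof -
    have "f x n - f y n \<le> K * dist x y + B" for x y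
      using dist_bounded[of "f x" n "f y"] growth[of x y] by (simp add: dist_real_def)
    then show ?thesis
      using lipschitz_minorant[OF \<open>0 \<le> K\<close>, of "\<lambda>x. f x n" B] by metis
  qed
  then obtain g where lip: "\<And>n. K-lipschitz_on UNIV (g n)"
    and upper: "\<And>n x. g n x \<le> f x n" and lower: "\<And>n x. f x n - B \<le> g n x"
    by metis
  define e where "e = (d - B) / 2"
  have "0 < e" using \<open>B < d\<close> by (simp add: e_def)
  show ?thesis
  proof (rule lipschitz_embedding_of_lipschitz_sphere_separation[OF lip \<open>0 < t\<close> \<open>0 < e\<close>])
    fix x y :: 'a assume "dist x y = t"
    \<comment> \<open>The supremum of the coordinate differences need not be attained, so a single
      coordinate is only sure to exceed bounds strictly below \<open>d\<close>.\<close>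
    have "\<exists>n. d - e < dist (f x n) (f y n)"
    proof (rule ccontr)
      assume "\<nexists>n. d - e < dist (f x n) (f y n)"
      then have "dist (f x) (f y) \<le> d - e"
        by (intro dist_bound) (auto simp: not_less)
      then show False using sep[OF \<open>dist x y = t\<close>] \<open>0 < e\<close> by linarith
    qed
    then obtain n where "d - e < \<bar>f x n - f y n\<bar>" by (auto simp: dist_real_def)
    moreover have "d - e = B + e" by (simp add: e_def field_simps)
    ultimately have "e \<le> \<bar>g n x - g n y\<bar>"
      using upper[of n x] upper[of n y] lower[of x n] lower[of y n] by linarith
    then show "\<exists>n. e \<le> \<bar>g n x - g n y\<bar>" ..
  qed
qed

section \<open>The weakest conditions yield a Lipschitz embedding\<close>

text \<open>
  Cut the segment from \<open>x\<close> to \<open>y\<close> into the least number of pieces of length at most \<open>a\<close>; that number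
  is below \<open>dist x y / a + 1\<close>, and \<open>f\<close> moves by at most \<open>b\<close> over each piece.
\<close>

lemma affine_growth:
  fixes f :: "'a::real_normed_vector \<Rightarrow> 'b::metric_space"
  assumes "0 < a" "0 \<le> b" and small: "\<And>x y. dist x y \<le> a \<Longrightarrow> dist (f x) (f y) \<le> b"
  shows "dist (f x) (f y) \<le> b / a * dist x y + b"
proof -
  define m where "m = nat \<lceil>dist x y / a\<rceil>"
  have steps: "dist (f x) (f (x + real k *\<^sub>R v)) \<le> real k * b" if "norm v \<le> a" for k v
  proof (induction k)
    case (Suc k)
    have "dist (f (x + real k *\<^sub>R v)) (f (x + real (Suc k) *\<^sub>R v)) \<le> b"
      using that by (intro small) (simp add: dist_norm algebra_simps)
    then show ?case
      using Suc dist_triangle[of "f x" "f (x + real (Suc k) *\<^sub>R v)" "f (x + real k *\<^sub>R v)"]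
      by (simp add: algebra_simps)
  qed simp
  show ?thesis
  proof (cases "x = y")
    case False
    then have "0 < dist x y / a" using \<open>0 < a\<close> by simp
    then have m: "0 < m" "dist x y / a \<le> real m" "real m \<le> dist x y / a + 1"
      unfolding m_def by linarith+
    have "norm ((y - x) /\<^sub>R real m) \<le> a"
      using m(1,2) \<open>0 < a\<close>
      by (simp add: dist_norm norm_minus_commute divide_simps mult.commute)
    from steps[OF this, of m] have "dist (f x) (f y) \<le> real m * b"
      using m(1) by simp
    also have "\<dots> \<le> (dist x y / a + 1) * b"
      using m(3) \<open>0 \<le> b\<close> by (rule mult_right_mono)
    finally show ?thesis by (simp add: algebra_simps)
  qed (use \<open>0 \<le> b\<close> in simp)
qed

lemma lipschitz_embedding_of_coarse_solvent:
  fixes f :: "'a::real_normed_vector \<Rightarrow> linfty"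
  assumes "coarse_map f" "solvent f"
  shows "\<exists>F :: 'a \<Rightarrow> linfty. lipschitz_embedding F"
proof -
  have "omega_mod f 1 < \<infinity>"
    using \<open>coarse_map f\<close> by (simp add: coarse_map_def)
  then obtain b where "0 \<le> b" "omega_mod f 1 = ennreal b"
    by (cases "omega_mod f 1") auto
  then have small: "dist (f x) (f y) \<le> b" if "dist x y \<le> 1" for x y
    using omega_mod_le_iff[of b f 1] that by auto
  obtain n :: nat where "b < real n" using reals_Archimedean2 by blast
  obtain R where "0 < R"
    and R: "\<And>x y. dist x y \<in> {R..R + real n} \<Longrightarrow> real n < dist (f x) (f y)"
    using \<open>solvent f\<close> unfolding solvent_def by blast
  show ?thesis
  proof (rule lipschitz_embedding_of_sphere_separation[OF \<open>0 \<le> b\<close> _ \<open>0 < R\<close> \<open>b < real n\<close>])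
    show "dist (f x) (f y) \<le> b * dist x y + b" for x y
      using affine_growth[of 1 b f x y] \<open>0 \<le> b\<close> small by simp
    show "real n \<le> dist (f x) (f y)" if "dist x y = R" for x y
      using R[of x y] that by simp
  qed
qed

lemma rho_bar_mod_pos_iff:
  "rho_bar_mod f t > 0 \<longleftrightarrow> (\<exists>e>0. \<forall>x y. dist x y = t \<longrightarrow> e \<le> dist (f x) (f y))"
proof
  assume "rho_bar_mod f t > 0"
  then obtain b where b: "0 < b" "b < rho_bar_mod f t" using dense by blast
  then obtain e where e: "0 \<le> e" "b = ennreal e"
    by (cases b) auto
  have "e \<le> dist (f x) (f y)" if "dist x y = t" for x y
  proof -
    have "rho_bar_mod f t \<le> ennreal (dist (f x) (f y))"
      unfolding rho_bar_mod_def using that by (intro INF_lower2[of "(x, y)"]) auto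
    then have "ennreal e \<le> ennreal (dist (f x) (f y))" using b(2) e(2) by (meson less_imp_le order_trans)
    then show ?thesis by (simp add: ennreal_le_iff)
  qed
  moreover have "0 < e" using b(1) e by simp
  ultimately show "\<exists>e>0. \<forall>x y. dist x y = t \<longrightarrow> e \<le> dist (f x) (f y)" by blast
next
  assume "\<exists>e>0. \<forall>x y. dist x y = t \<longrightarrow> e \<le> dist (f x) (f y)"
  then obtain e where "0 < e" "\<And>x y. dist x y = t \<Longrightarrow> e \<le> dist (f x) (f y)" by blast
  then have "ennreal e \<le> rho_bar_mod f t"
    unfolding rho_bar_mod_def by (intro INF_greatest) (auto intro: ennreal_leI)
  moreover have "0 < ennreal e" using \<open>0 < e\<close> by simp
  ultimately show "rho_bar_mod f t > 0" by (rule order_less_le_trans[rotated])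
qed

lemma lipschitz_embedding_of_uniformly_continuous_almost_uncollapsed:
  fixes f :: "'a::real_normed_vector \<Rightarrow> linfty"
  assumes "uniformly_continuous_on UNIV f" "almost_uncollapsed f"
  shows "\<exists>F :: 'a \<Rightarrow> linfty. lipschitz_embedding F"
proof -
  obtain t d where "0 < t" "0 < d" and d: "\<And>x y. dist x y = t \<Longrightarrow> d \<le> dist (f x) (f y)"
    using \<open>almost_uncollapsed f\<close> unfolding almost_uncollapsed_def rho_bar_mod_pos_iff by blast
  have "0 < d / 2" "0 \<le> d / 2" "d / 2 < d" using \<open>0 < d\<close> by simp_all
  obtain a where "0 < a" and a: "\<And>x y. dist x y < a \<Longrightarrow> dist (f x) (f y) < d / 2"
    using \<open>uniformly_continuous_on UNIV f\<close> \<open>0 < d / 2\<close>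
    unfolding uniformly_continuous_on_def by (metis UNIV_I)
  have small: "dist (f x) (f y) \<le> d / 2" if "dist x y \<le> a / 2" for x y
    using a[of x y] that \<open>0 < a\<close> by simp
  show ?thesis
  proof (rule lipschitz_embedding_of_sphere_separation[OF _ _ \<open>0 < t\<close> \<open>d / 2 < d\<close> d])
    show "0 \<le> (d / 2) / (a / 2)" using \<open>0 < a\<close> \<open>0 < d\<close> by simp
    show "dist (f x) (f y) \<le> (d / 2) / (a / 2) * dist x y + d / 2" for x y
      using \<open>0 < a\<close> \<open>0 \<le> d / 2\<close> small by (intro affine_growth) auto
  qed
qed

section \<open>Comparison of the conditions on a single map\<close>

lemma solvent_if_expanding:
  assumes "expanding_map f"
  shows "solvent f"
  unfolding solvent_def
proof (intro allI)
  fix n :: nat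
  have "\<forall>\<^sub>F t in at_top. ennreal (real n + 1) < rho_mod f t"
    using assms unfolding expanding_map_def by (rule order_tendstoD) simp
  then obtain T where T: "\<And>t. T \<le> t \<Longrightarrow> ennreal (real n + 1) < rho_mod f t"
    by (auto simp: eventually_at_top_linorder)
  define R where "R = max T 1"
  have "ennreal (real n + 1) \<le> rho_mod f R"
    using T[of R] unfolding R_def by (meson less_imp_le max.cobounded1)
  then have "real n + 1 \<le> dist (f x) (f y)" if "R \<le> dist x y" for x y
    using that unfolding rho_mod_ge_iff by blast
  then have "\<forall>x y. dist x y \<in> {R..R + real n} \<longrightarrow> real n < dist (f x) (f y)"
    by fastforce
  then show "\<exists>R>0. \<forall>x y. dist x y \<in> {R..R + real n} \<longrightarrow> real n < dist (f x) (f y)"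
    by (intro exI[of _ R]) (simp add: R_def)
qed

lemma almost_uncollapsed_if_uniform_embedding:
  assumes "uniform_embedding f"
  shows "almost_uncollapsed f"
proof -
  have "rho_mod f 1 > 0"
    using assms by (simp add: uniform_embedding_iff_moduli)
  then have "rho_bar_mod f 1 > 0"
    unfolding rho_mod_pos_iff rho_bar_mod_pos_iff by force
  then show ?thesis
    unfolding almost_uncollapsed_def using zero_less_one by blast
qed

lemma strong_embedding_if_lipschitz_embedding:
  fixes f :: "'a::metric_space \<Rightarrow> 'b::metric_space"
  assumes "lipschitz_embedding f"
  shows "strong_embedding f"
proof -
  obtain C c where "0 \<le> C" and C: "\<And>x y. dist (f x) (f y) \<le> C * dist x y"
    and "0 < c" and c: "\<And>x y. c * dist x y \<le> dist (f x) (f y)"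
    using assms by (rule lipschitz_embeddingE) blast
  have "uniform_embedding f"
    using assms unfolding uniform_embedding_def lipschitz_embedding_def
    by (auto intro: lipschitz_on_uniformly_continuous)
  moreover have "coarse_map f"
    unfolding coarse_map_def
  proof (intro allI impI)
    fix t :: real assume "0 \<le> t"
    have "dist (f x) (f y) \<le> C * t" if "dist x y \<le> t" for x y
      using C[of x y] mult_left_mono[OF that \<open>0 \<le> C\<close>] by linarith
    then have "omega_mod f t \<le> ennreal (C * t)"
      using \<open>0 \<le> C\<close> \<open>0 \<le> t\<close> by (simp add: omega_mod_le_iff)
    then show "omega_mod f t < \<infinity>"
      by (rule order_le_less_trans) simp
  qed
  moreover have "expanding_map f"
    unfolding expanding_map_def
  proof (rule tendsto_sandwich)
    show "((\<lambda>t. ennreal (c * t)) \<longlongrightarrow> \<infinity>) at_top"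
      unfolding infinity_ennreal_def ennreal_tendsto_top_eq_at_top
      by (intro filterlim_tendsto_pos_mult_at_top[OF tendsto_const \<open>0 < c\<close>]
          filterlim_ident)
    have "ennreal (c * t) \<le> rho_mod f t" for t
      unfolding rho_mod_ge_iff
    proof (intro allI impI)
      fix x y :: 'a assume "t \<le> dist x y"
      then show "c * t \<le> dist (f x) (f y)"
        using c[of x y] mult_left_mono[of t "dist x y" c] \<open>0 < c\<close> by linarith
    qed
    then show "\<forall>\<^sub>F t in at_top. ennreal (c * t) \<le> rho_mod f t" by simp
    show "\<forall>\<^sub>F t in at_top. rho_mod f t \<le> \<infinity>" by simp
  qed simp
  ultimately show ?thesis
    by (simp add: strong_embedding_def coarse_embedding_def)
qed

theorem theorem1p7:
  shows "((\<exists>f :: 'a::banach \<Rightarrow> linfty. coarse_embedding f)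
           \<longleftrightarrow> (\<exists>f :: 'a \<Rightarrow> linfty. uniform_embedding f))
       \<and> ((\<exists>f :: 'a \<Rightarrow> linfty. uniform_embedding f)
           \<longleftrightarrow> (\<exists>f :: 'a \<Rightarrow> linfty. strong_embedding f))
       \<and> ((\<exists>f :: 'a \<Rightarrow> linfty. strong_embedding f)
           \<longleftrightarrow> (\<exists>f :: 'a \<Rightarrow> linfty. coarse_map f \<and> solvent f))
       \<and> ((\<exists>f :: 'a \<Rightarrow> linfty. coarse_map f \<and> solvent f)
           \<longleftrightarrow> (\<exists>f :: 'a \<Rightarrow> linfty. uniformly_continuous_on UNIV f \<and> almost_uncollapsed f))
       \<and> ((\<exists>f :: 'a \<Rightarrow> linfty. uniformly_continuous_on UNIV f \<and> almost_uncollapsed f)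
           \<longleftrightarrow> (\<exists>f :: 'a \<Rightarrow> linfty. lipschitz_embedding f))"
proof -
  let ?L = "\<exists>f :: 'a \<Rightarrow> linfty. lipschitz_embedding f"
  have coarse_solvent: ?L if "coarse_map f" "solvent f" for f :: "'a \<Rightarrow> linfty"
    using that by (rule lipschitz_embedding_of_coarse_solvent)
  have uncollapsed: ?L if "uniformly_continuous_on UNIV f" "almost_uncollapsed f"
    for f :: "'a \<Rightarrow> linfty"
    using that by (rule lipschitz_embedding_of_uniformly_continuous_almost_uncollapsed)
  have coarse: ?L if "coarse_embedding f" for f :: "'a \<Rightarrow> linfty"
    using that coarse_solvent solvent_if_expanding unfolding coarse_embedding_def by blast
  have uniform: ?L if "uniform_embedding f" for f :: "'a \<Rightarrow> linfty"
    using that uncollapsed almost_uncollapsed_if_uniform_embedding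
    unfolding uniform_embedding_def by blast
  have strong: "uniform_embedding f" "coarse_embedding f" "coarse_map f" "solvent f"
      "uniformly_continuous_on UNIV f" "almost_uncollapsed f" "strong_embedding f"
    if "lipschitz_embedding f" for f :: "'a \<Rightarrow> linfty"
    using strong_embedding_if_lipschitz_embedding[OF that] solvent_if_expanding[of f]
      almost_uncollapsed_if_uniform_embedding[of f]
    by (auto simp: strong_embedding_def coarse_embedding_def uniform_embedding_def)
  have "(\<exists>f :: 'a \<Rightarrow> linfty. coarse_embedding f) \<longleftrightarrow> ?L"
    using coarse strong by blast
  moreover have "(\<exists>f :: 'a \<Rightarrow> linfty. uniform_embedding f) \<longleftrightarrow> ?L"
    using uniform strong by blast
  moreover have "(\<exists>f :: 'a \<Rightarrow> linfty. strong_embedding f) \<longleftrightarrow> ?L"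
    using uniform strong unfolding strong_embedding_def by blast
  moreover have "(\<exists>f :: 'a \<Rightarrow> linfty. coarse_map f \<and> solvent f) \<longleftrightarrow> ?L"
    using coarse_solvent strong by blast
  moreover have "(\<exists>f :: 'a \<Rightarrow> linfty. uniformly_continuous_on UNIV f \<and> almost_uncollapsed f) \<longleftrightarrow> ?L"
    using uncollapsed strong by blast
  ultimately show ?thesis by argo
qed

end
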